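(* Let $X$ be a real Hilbert space, let $\mathcal F\subset\mathcal N(X)$, and let $d$ be a metric on $\mathcal F$ such that $(\mathcal F,d)$ is a complete metric space and $d\ge\rho$, i.e., $d(T_1,T_2)\ge\rho(T_1,T_2)$ for all $T_1,T_2\in\mathcal F$. Assume that the set $\mathcal C$ of contraction mappings (belonging to $\mathcal F$) is dense in $(\mathcal F,d)$. Then there exists a set $G\subset\mathcal F$ which is a countable intersection of open everywhere dense sets in $(\mathcal F,d)$ such that each $T\in G$ is super-regular. In particular, for each $T\in G$, $\operatorname{Fix}(T)=(\operatorname{Id}-T)^{-1}(0)\ne\varnothing$ is a singleton.
   Context: $X$ is a real Hilbert space with norm $\|\cdot\|$; $\operatorname{Id}$ is the identity map. $\mathcal N(X)$ is the set of nonexpansive maps $T:X\to X$, i.e., $\|Tx-Ty\|\le\|x-y\|$ for all $x,y\in X$. For $T_1,T_2\in\mathcal N(X)$ and $n\in\{1,2,\dots\}$ put $\|T_1-T_2\|_n:=\sup_{\|x\|\le n}\|T_1x-T_2x\|$ and $$\rho(T_1,T_2):=\sum_{n=1}^\infty\frac1{2^n}\frac{\|T_1-T_2\|_n}{1+\|T_1-T_2\|_n},$$ a metric on $\mathcal N(X)$. A map $T\in\mathcal N(X)$ is a contraction (with modulus $l$) if there is $0\le l<1$ with $\|Tx-Ty\|\le l\|x-y\|$ for all $x,y\in X$. A map $T:X\to X$ is super-regular if there exists a unique $x_T\in X$ such that for each $s>0$, $T^nx\to x_T$ as $n\to\infty$ uniformly for $x$ in the closed ball $\{x:\|x\|\le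 s\}$. $\operatorname{Fix}(T):=\{x\in X: Tx=x\}$. *)

theory Defs
  imports "HOL-Analysis.Analysis"
begin

definition nonexpansive :: "('a::real_inner \<Rightarrow> 'a) \<Rightarrow> bool"
  where "nonexpansive T \<longleftrightarrow> 1-lipschitz_on UNIV T"

definition contraction :: "('a::real_inner \<Rightarrow> 'a) \<Rightarrow> bool"
  where "contraction T \<longleftrightarrow> (\<exists>l::real. 0 \<le> l \<and> l < 1 \<and> l-lipschitz_on UNIV T)"

definition ball_dist :: "nat \<Rightarrow> ('a::real_inner \<Rightarrow> 'a) \<Rightarrow> ('a \<Rightarrow> 'a) \<Rightarrow> real"
  where "ball_dist n T\<^sub>1 T\<^sub>2 = (SUP x \<in> cball 0 (real n). norm (T\<^sub>1 x - T\<^sub>2 x))"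

text \<open>The sum over \<open>n = 1, 2, \<dots>\<close> is written as a series indexed from \<open>0\<close>.\<close>

definition rho :: "('a::real_inner \<Rightarrow> 'a) \<Rightarrow> ('a \<Rightarrow> 'a) \<Rightarrow> real"
  where "rho T\<^sub>1 T\<^sub>2 =
    (\<Sum>n. 1 / 2 ^ Suc n * (ball_dist (Suc n) T\<^sub>1 T\<^sub>2 / (1 + ball_dist (Suc n) T\<^sub>1 T\<^sub>2)))"

definition super_regular :: "('a::real_inner \<Rightarrow> 'a) \<Rightarrow> bool"
  where "super_regular T \<longleftrightarrow>
    (\<exists>!x. \<forall>s>0. uniform_limit (cball 0 s) (\<lambda>n. T ^^ n) (\<lambda>_. x) sequentially)"

definition Fix :: "('a \<Rightarrow> 'a) \<Rightarrow> 'a set"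
  where "Fix T = {x. T x = x}"

text \<open>For nonexpansive maps the real-valued supremum and series above are genuine
  (neither takes a default value).\<close>

lemma bdd_above_ball_dist:
  fixes T\<^sub>1 T\<^sub>2 :: "'a::real_inner \<Rightarrow> 'a"
  assumes "nonexpansive T\<^sub>1" "nonexpansive T\<^sub>2"
  shows "bdd_above ((\<lambda>x. norm (T\<^sub>1 x - T\<^sub>2 x)) ` cball 0 r)"
proof (rule bdd_aboveI2)
  fix x :: 'a assume x: "x \<in> cball 0 r"
  have *: "norm (T x - T 0) \<le> r" if "nonexpansive T" for T :: "'a \<Rightarrow> 'a"
    using lipschitz_on_normD[of 1 UNIV T x 0] that x by (simp add: nonexpansive_def)
  have "norm (T\<^sub>1 x - T\<^sub>2 x) = norm ((T\<^sub>1 x - T\<^sub>1 0) - (T\<^sub>2 x - T\<^sub>2 0) + (T\<^sub>1 0 - T\<^sub>2 0))"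
    by simp
  also have "\<dots> \<le> norm (T\<^sub>1 x - T\<^sub>1 0) + norm (T\<^sub>2 x - T\<^sub>2 0) + norm (T\<^sub>1 0 - T\<^sub>2 0)"
    by (meson norm_triangle_ineq norm_triangle_ineq4 add_right_mono order_trans)
  finally show "norm (T\<^sub>1 x - T\<^sub>2 x) \<le> 2 * r + norm (T\<^sub>1 0 - T\<^sub>2 0)"
    using *[OF assms(1)] *[OF assms(2)] by simp
qed

lemma ball_dist_nonneg:
  assumes "nonexpansive T\<^sub>1" "nonexpansive T\<^sub>2"
  shows "0 \<le> ball_dist n T\<^sub>1 T\<^sub>2"
  unfolding ball_dist_def
  by (rule cSUP_upper2[OF bdd_above_ball_dist[OF assms], of 0]) auto

lemma summable_rho:
  assumes "nonexpansive T\<^sub>1" "nonexpansive T\<^sub>2"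
  shows "summable (\<lambda>n. 1 / 2 ^ Suc n *
    (ball_dist (Suc n) T\<^sub>1 T\<^sub>2 / (1 + ball_dist (Suc n) T\<^sub>1 T\<^sub>2)))"
proof (rule summable_comparison_test')
  show "summable (\<lambda>n. (1/2::real) ^ n)"
    by (rule summable_geometric) simp
  fix n :: nat
  define b where "b = ball_dist (Suc n) T\<^sub>1 T\<^sub>2"
  have b: "0 \<le> b" unfolding b_def by (rule ball_dist_nonneg[OF assms])
  have "1 / 2 ^ Suc n * (b / (1 + b)) \<le> (1/2) ^ n * (1::real)"
    by (rule mult_mono) (use b in \<open>auto simp: field_simps\<close>)
  moreover have "0 \<le> 1 / 2 ^ Suc n * (b / (1 + b))" using b by simp
  ultimately show "norm (1 / 2 ^ Suc n * (ball_dist (Suc n) T\<^sub>1 T\<^sub>2 /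
      (1 + ball_dist (Suc n) T\<^sub>1 T\<^sub>2))) \<le> (1/2) ^ n"
    unfolding b_def[symmetric] real_norm_def by linarith
qed

end

theory Submission
  imports Defs
begin

text \<open>
  A contraction \<open>C\<close> with fixed point \<open>p\<close> is stable under perturbation: if \<open>T\<close> is uniformly
  \<open>\<delta>\<close>-close to the \<open>l\<close>-Lipschitz map \<open>C\<close> on \<open>cball p r\<close>, where \<open>\<delta> = (1 - l) * \<epsilon>\<close> and \<open>\<epsilon> \<le> r\<close>,
  then \<open>T\<close> maps this ball into itself and
  \<open>norm ((T ^^ n) x - p) \<le> l ^ n * r + \<epsilon>\<close> for every \<open>x\<close> in it
  (\<open>perturbed_contraction_orbit\<close>). If \<open>r\<close> is so large that \<open>cball 0 s\<close> is contained in
  \<open>cball p r\<close>, then all late iterates of \<open>T\<close> send \<open>cball 0 s\<close> into \<open>cball p (2 * \<epsilon>)\<close>.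
  Since \<open>rho\<close>, and so \<open>d\<close>, controls the uniform distance on each ball
  (\<open>ball_dist_less_of_rho\<close>), this holds for every \<open>T\<close> in some \<open>d\<close>-ball around \<open>C\<close>
  (\<open>contraction_neighbourhood\<close>).

  For each \<open>n\<close>, let \<open>U n\<close> be the union of such \<open>d\<close>-balls over all contractions in \<open>F\<close>, with
  \<open>s = n + 1\<close> and \<open>2 * \<epsilon> = 1 / (n + 1)\<close>. It is open, and dense because it contains all
  contractions in \<open>F\<close>. If \<open>T\<close> lies in every \<open>U n\<close>, then its iterates eventually map any
  given ball into arbitrarily small balls; so the orbit of \<open>0\<close> is Cauchy, and every ball is drawn
  uniformly to its limit (\<open>super_regular_if_squeezes\<close>). The limit is the only fixed point
  because \<open>T\<close> is continuous and fixed points are constant orbits.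
\<close>

section \<open>Maps whose iterates squeeze balls\<close>

text \<open>All late iterates of \<open>T\<close> map the ball of radius \<open>s\<close> around the origin into one common
  closed ball of radius \<open>\<epsilon>\<close>, whose centre is not prescribed.\<close>

definition squeezes :: "('a::real_normed_vector \<Rightarrow> 'a) \<Rightarrow> real \<Rightarrow> real \<Rightarrow> bool"
  where "squeezes T s \<epsilon> \<longleftrightarrow>
    (\<exists>p N. \<forall>n\<ge>N. \<forall>x\<in>cball 0 s. norm ((T ^^ n) x - p) \<le> \<epsilon>)"

lemma squeezes_mono:
  assumes "squeezes T s \<epsilon>" "s' \<le> s" "\<epsilon> \<le> \<epsilon>'"
  shows "squeezes T s' \<epsilon>'"
proof -
  obtain p N where pN: "\<And>n x. n \<ge> N \<Longrightarrow> x \<in> cball 0 s \<Longrightarrow> norm ((T ^^ n) x - p) \<le> \<epsilon>"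
    using assms(1) unfolding squeezes_def by blast
  have "norm ((T ^^ n) x - p) \<le> \<epsilon>'" if "n \<ge> N" "x \<in> cball 0 s'" for n x
    using pN[of n x] that assms(2,3) by force
  then show ?thesis unfolding squeezes_def by blast
qed

lemma squeezes_imp_uniform_limit:
  fixes T :: "'a::{real_normed_vector, complete_space} \<Rightarrow> 'a"
  assumes sq: "\<And>s \<epsilon>. 0 < \<epsilon> \<Longrightarrow> squeezes T s \<epsilon>"
  obtains z where "\<And>s. uniform_limit (cball 0 s) (\<lambda>n. T ^^ n) (\<lambda>_. z) sequentially"
proof -
  have "Cauchy (\<lambda>n. (T ^^ n) 0)"
  proof (rule metric_CauchyI)
    fix e :: real assume "0 < e"
    then obtain p N where pN: "\<And>n. n \<ge> N \<Longrightarrow> dist ((T ^^ n) 0) p \<le> e / 3"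
      using sq[of "e / 3" 0] unfolding squeezes_def by (auto simp: dist_norm)
    have "dist ((T ^^ m) 0) ((T ^^ n) 0) < e" if "m \<ge> N" "n \<ge> N" for m n
      using pN[OF that(1)] pN[OF that(2)]
        dist_triangle2[of "(T ^^ m) 0" "(T ^^ n) 0" p] \<open>0 < e\<close> by linarith
    then show "\<exists>M. \<forall>m\<ge>M. \<forall>n\<ge>M. dist ((T ^^ m) 0) ((T ^^ n) 0) < e" by blast
  qed
  then obtain z where z: "(\<lambda>n. (T ^^ n) 0) \<longlonglongrightarrow> z"
    using Cauchy_convergent convergent_def by blast
  have "uniform_limit (cball 0 s) (\<lambda>n. T ^^ n) (\<lambda>_. z) sequentially" for s
  proof (rule uniform_limitI)
    fix e :: real assume "0 < e"
    \<comment> \<open>The radius is made nonnegative so that the orbit of \<open>0\<close> is squeezed as well.\<close>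
    then have "squeezes T (max s 0) (e / 3)" by (intro sq) simp
    then obtain p N where
      pN: "\<And>n x. n \<ge> N \<Longrightarrow> x \<in> cball 0 (max s 0) \<Longrightarrow> dist ((T ^^ n) x) p \<le> e / 3"
      unfolding squeezes_def dist_norm by blast
    have "\<forall>\<^sub>F n in sequentially. dist ((T ^^ n) 0) z < e / 3"
      by (rule tendstoD[OF z]) (use \<open>0 < e\<close> in simp)
    then show "\<forall>\<^sub>F n in sequentially. \<forall>x\<in>cball 0 s. dist ((T ^^ n) x) z < e"
      using eventually_ge_at_top[of N]
    proof eventually_elim
      case (elim n)
      show ?case
      proof
        fix x :: 'a assume "x \<in> cball 0 s"
        then have "dist ((T ^^ n) x) p \<le> e / 3" "dist ((T ^^ n) 0) p \<le> e / 3"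
          using pN[OF elim(2)] by auto
        with elim(1) show "dist ((T ^^ n) x) z < e"
          using dist_triangle[of "(T ^^ n) x" z "(T ^^ n) 0"]
            dist_triangle2[of "(T ^^ n) x" "(T ^^ n) 0" p] by linarith
      qed
    qed
  qed
  then show ?thesis using that by blast
qed

lemma uniform_limit_cball_tendsto:
  fixes f :: "'i \<Rightarrow> 'a::real_normed_vector \<Rightarrow> 'b::metric_space"
  assumes "\<forall>s>0. uniform_limit (cball 0 s) f (\<lambda>_. z) F"
  shows "((\<lambda>n. f n x) \<longlongrightarrow> z) F"
proof -
  have "uniform_limit (cball 0 (norm x + 1)) f (\<lambda>_. z) F"
    using assms by (simp add: add_nonneg_pos)
  then show ?thesis by (rule tendsto_uniform_limitI) simp
qed

lemma super_regular_if_squeezes: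
  fixes T :: "'a::{real_inner, complete_space} \<Rightarrow> 'a"
  assumes "\<And>s \<epsilon>. 0 < \<epsilon> \<Longrightarrow> squeezes T s \<epsilon>"
  shows "super_regular T"
proof -
  obtain z where z: "\<And>s. uniform_limit (cball 0 s) (\<lambda>n. T ^^ n) (\<lambda>_. z) sequentially"
    using squeezes_imp_uniform_limit[of T] assms by blast
  show ?thesis
    unfolding super_regular_def
  proof (rule ex1I[of _ z])
    show "\<forall>s>0. uniform_limit (cball 0 s) (\<lambda>n. T ^^ n) (\<lambda>_. z) sequentially"
      using z by blast
    then have lz: "(\<lambda>n. (T ^^ n) 0) \<longlonglongrightarrow> z"
      by (rule uniform_limit_cball_tendsto)
    fix y assume "\<forall>s>0. uniform_limit (cball 0 s) (\<lambda>n. T ^^ n) (\<lambda>_. y) sequentially"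
    then have "(\<lambda>n. (T ^^ n) 0) \<longlonglongrightarrow> y"
      by (rule uniform_limit_cball_tendsto)
    with lz show "y = z" using LIMSEQ_unique by blast
  qed
qed

lemma super_regular_Fix:
  assumes "super_regular T" "continuous_on UNIV T"
  obtains z where "Fix T = {z}"
proof -
  obtain z where "\<forall>s>0. uniform_limit (cball 0 s) (\<lambda>n. T ^^ n) (\<lambda>_. z) sequentially"
    using ex1_implies_ex[OF assms(1)[unfolded super_regular_def]] ..
  then have lim: "(\<lambda>n. (T ^^ n) x) \<longlonglongrightarrow> z" for x
    by (rule uniform_limit_cball_tendsto)
  have "(\<lambda>n. T ((T ^^ n) z)) \<longlonglongrightarrow> T z"
    using continuous_on_tendsto_compose[OF assms(2) lim[of z]] by simp
  moreover have "(\<lambda>n. T ((T ^^ n) z)) \<longlonglongrightarrow> z"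
    using LIMSEQ_Suc[OF lim[of z]] by simp
  ultimately have "T z = z" using LIMSEQ_unique by blast
  moreover have "y = z" if "T y = y" for y
  proof -
    have "(T ^^ n) y = y" for n
      by (induction n) (simp_all add: that)
    then show ?thesis using lim[of y] by (simp add: LIMSEQ_const_iff)
  qed
  ultimately have "Fix T = {z}" unfolding Fix_def by blast
  then show ?thesis by (rule that)
qed

section \<open>Perturbations of a contraction\<close>

text \<open>Closeness of \<open>T\<close> to \<open>C\<close> is needed only on the ball around \<open>p\<close>, because the orbits of
  \<open>T\<close> that start in this ball never leave it.\<close>

lemma perturbed_contraction_orbit:
  fixes T C :: "'a::real_normed_vector \<Rightarrow> 'a"
  assumes C: "l-lipschitz_on UNIV C" "0 \<le> l" "l < 1" "C p = p"
    and close: "\<And>x. x \<in> cball p r \<Longrightarrow> norm (T x - C x) \<le> (1 - l) * \<epsilon>"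
    and "0 \<le> \<epsilon>" "\<epsilon> \<le> r" "x \<in> cball p r"
  shows "norm ((T ^^ n) x - p) \<le> l ^ n * r + \<epsilon>"
proof -
  have step: "norm (T y - p) \<le> (1 - l) * \<epsilon> + l * norm (y - p)" if "y \<in> cball p r" for y
  proof -
    have "norm (T y - p) \<le> norm (T y - C y) + norm (C y - C p)"
      using norm_triangle_ineq[of "T y - C y" "C y - C p"] \<open>C p = p\<close> by simp
    also have "\<dots> \<le> (1 - l) * \<epsilon> + l * norm (y - p)"
      using close[OF that] lipschitz_on_normD[OF C(1), of y p] by simp
    finally show ?thesis .
  qed
  have "norm ((T ^^ n) x - p) \<le> r \<and> norm ((T ^^ n) x - p) \<le> l ^ n * r + \<epsilon>"
  proof (induction n)
    case 0
    show ?case using assms(6-8) by (simp add: dist_norm norm_minus_commute)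
  next
    case (Suc n)
    let ?y = "(T ^^ n) x"
    have st: "norm (T ?y - p) \<le> (1 - l) * \<epsilon> + l * norm (?y - p)"
      using Suc by (intro step) (simp add: dist_norm norm_minus_commute)
    have "(1 - l) * \<epsilon> \<le> (1 - l) * r"
      using assms(3,7) by (intro mult_left_mono) auto
    moreover have "l * norm (?y - p) \<le> l * r" "l * norm (?y - p) \<le> l * (l ^ n * r + \<epsilon>)"
      using Suc assms(2) by (auto intro!: mult_left_mono)
    ultimately show ?case
      using st by (simp add: algebra_simps)
  qed
  then show ?thesis by blast
qed

lemma squeezes_near_contraction:
  fixes C :: "'a::{real_inner, complete_space} \<Rightarrow> 'a"
  assumes "contraction C" "0 < \<epsilon>"
  obtains R \<delta> where "0 < \<delta>"
    "\<And>T. (\<And>x. x \<in> cball 0 R \<Longrightarrow> norm (T x - C x) \<le> \<delta>) \<Longrightarrow> squeezes T s \<epsilon>"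
proof -
  obtain l where l: "0 \<le> l" "l < 1" "l-lipschitz_on UNIV C"
    using assms(1) unfolding contraction_def by blast
  have "\<exists>!x. C x = x"
    by (rule banach_fix_type[OF l(1,2)]) (use l(3) in \<open>auto simp: lipschitz_on_def\<close>)
  then obtain p where p: "C p = p" by blast
  \<comment> \<open>The ball around \<open>p\<close> must contain \<open>cball 0 s\<close> and have radius at least \<open>\<epsilon> / 2\<close>.\<close>
  define r where "r = max s 0 + norm p + \<epsilon>"
  have r: "0 < r" using assms(2) by (simp add: r_def add_nonneg_pos)
  have "(\<lambda>n. l ^ n * r) \<longlonglongrightarrow> 0 * r"
    by (intro tendsto_intros) (use l in \<open>simp add: LIMSEQ_realpow_zero\<close>)
  then have "\<forall>\<^sub>F n in sequentially. l ^ n * r < \<epsilon> / 2"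
    by (rule order_tendstoD) (use assms(2) in simp)
  then obtain N where N: "\<And>n. n \<ge> N \<Longrightarrow> l ^ n * r < \<epsilon> / 2"
    by (auto simp: eventually_sequentially)
  show ?thesis
  proof (rule that[of "(1 - l) * (\<epsilon> / 2)" "norm p + r"])
    show "0 < (1 - l) * (\<epsilon> / 2)" using l assms(2) by simp
    fix T assume T: "\<And>x. x \<in> cball 0 (norm p + r) \<Longrightarrow> norm (T x - C x) \<le> (1 - l) * (\<epsilon> / 2)"
    have near: "norm (T x - C x) \<le> (1 - l) * (\<epsilon> / 2)" if "x \<in> cball p r" for x
      using that norm_triangle_ineq[of "x - p" p]
      by (intro T) (simp add: dist_norm norm_minus_commute)
    have "norm ((T ^^ n) x - p) \<le> \<epsilon>" if "n \<ge> N" "x \<in> cball 0 s" for n x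
    proof -
      have "x \<in> cball p r"
        using that(2) norm_triangle_ineq4[of p x] assms(2) by (simp add: r_def dist_norm)
      moreover have "\<epsilon> / 2 \<le> r"
        using assms(2) norm_ge_zero[of p] by (simp add: r_def)
      ultimately have "norm ((T ^^ n) x - p) \<le> l ^ n * r + \<epsilon> / 2"
        using assms(2) by (intro perturbed_contraction_orbit[OF l(3,1,2) p near]) auto
      then show ?thesis using N[OF that(1)] by linarith
    qed
    then show "squeezes T s \<epsilon>" unfolding squeezes_def by blast
  qed
qed

lemma ball_dist_less_of_rho:
  assumes ne: "nonexpansive T\<^sub>1" "nonexpansive T\<^sub>2"
    and "0 \<le> \<delta>" and rho: "rho T\<^sub>1 T\<^sub>2 < 1 / 2 ^ Suc m * (\<delta> / (1 + \<delta>))"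
  shows "ball_dist (Suc m) T\<^sub>1 T\<^sub>2 < \<delta>"
proof (rule ccontr)
  assume "\<not> ball_dist (Suc m) T\<^sub>1 T\<^sub>2 < \<delta>"
  then have b: "\<delta> \<le> ball_dist (Suc m) T\<^sub>1 T\<^sub>2" by simp
  let ?f = "\<lambda>n. 1 / 2 ^ Suc n *
    (ball_dist (Suc n) T\<^sub>1 T\<^sub>2 / (1 + ball_dist (Suc n) T\<^sub>1 T\<^sub>2))"
  have "\<delta> / (1 + \<delta>) \<le> ball_dist (Suc m) T\<^sub>1 T\<^sub>2 / (1 + ball_dist (Suc m) T\<^sub>1 T\<^sub>2)"
    using b \<open>0 \<le> \<delta>\<close> by (simp add: field_simps)
  then have "1 / 2 ^ Suc m * (\<delta> / (1 + \<delta>)) \<le> ?f m"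
    by (intro mult_left_mono) auto
  also have "?f m = sum ?f {m}" by simp
  also have "\<dots> \<le> rho T\<^sub>1 T\<^sub>2"
    unfolding rho_def
    by (rule sum_le_suminf[OF summable_rho[OF ne]]) (auto simp: ball_dist_nonneg[OF ne])
  finally show False using rho by simp
qed

lemma contraction_neighbourhood:
  fixes C :: "'a::{real_inner, complete_space} \<Rightarrow> 'a"
  assumes "contraction C" "0 < \<epsilon>"
  obtains \<eta> where "0 < \<eta>"
    "\<And>T. nonexpansive T \<Longrightarrow> rho C T < \<eta> \<Longrightarrow> squeezes T s \<epsilon>"
proof -
  obtain R \<delta> where \<delta>: "0 < \<delta>" and
    sq: "\<And>T. (\<And>x. x \<in> cball 0 R \<Longrightarrow> norm (T x - C x) \<le> \<delta>) \<Longrightarrow> squeezes T s \<epsilon>"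
    using squeezes_near_contraction[OF assms, of s] by blast
  obtain m :: nat where m: "R \<le> real m" using real_arch_simple by blast
  have C: "nonexpansive C"
    using assms(1) unfolding contraction_def nonexpansive_def
    using lipschitz_on_le less_imp_le by blast
  show ?thesis
  proof (rule that[of "1 / 2 ^ Suc m * (\<delta> / (1 + \<delta>))"])
    show "0 < 1 / 2 ^ Suc m * (\<delta> / (1 + \<delta>))" using \<delta> by simp
    fix T :: "'a \<Rightarrow> 'a"
    assume T: "nonexpansive T" and rho: "rho C T < 1 / 2 ^ Suc m * (\<delta> / (1 + \<delta>))"
    have bd: "ball_dist (Suc m) C T < \<delta>"
      using ball_dist_less_of_rho[OF C T _ rho] \<delta> by simp
    show "squeezes T s \<epsilon>"
    proof (rule sq)
      fix x :: 'a assume "x \<in> cball 0 R"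
      then have "x \<in> cball 0 (real (Suc m))" using m by simp
      then have "norm (C x - T x) \<le> ball_dist (Suc m) C T"
        unfolding ball_dist_def by (rule cSUP_upper[OF _ bdd_above_ball_dist[OF C T]])
      with bd show "norm (T x - C x) \<le> \<delta>" by (simp add: norm_minus_commute)
    qed
  qed
qed

section \<open>Generic super-regularity\<close>

theorem theorem2p13:
  fixes F :: "('a::{real_inner, complete_space} \<Rightarrow> 'a) set"
    and d :: "('a \<Rightarrow> 'a) \<Rightarrow> ('a \<Rightarrow> 'a) \<Rightarrow> real"
  assumes "F \<subseteq> Collect nonexpansive"
    and "Metric_space F d"
    and "Metric_space.mcomplete F d"
    and "\<And>T\<^sub>1 T\<^sub>2. T\<^sub>1 \<in> F \<Longrightarrow> T\<^sub>2 \<in> F \<Longrightarrow> rho T\<^sub>1 T\<^sub>2 \<le> d T\<^sub>1 T\<^sub>2"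
    and "Metric_space.mtopology F d closure_of {T \<in> F. contraction T} = F"
  shows "\<exists>G \<subseteq> F.
    (\<exists>U :: nat \<Rightarrow> ('a \<Rightarrow> 'a) set.
       (\<forall>n. openin (Metric_space.mtopology F d) (U n) \<and>
            Metric_space.mtopology F d closure_of U n = F) \<and>
       G = (\<Inter>n. U n)) \<and>
    (\<forall>T \<in> G. super_regular T) \<and>
    (\<forall>T \<in> G. Fix T = (\<lambda>x. x - T x) -` {0} \<and> Fix T \<noteq> {} \<and> is_singleton (Fix T))"
proof -
  interpret Metric_space F d by fact
  let ?K = "{C \<in> F. contraction C}"
  have nbhd: "\<exists>\<eta>>0. \<forall>T\<in>mball C \<eta>. squeezes T (real (Suc n)) (1 / real (Suc n))"
    if C: "C \<in> ?K" for C n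
  proof -
    have "contraction C" "0 < 1 / real (Suc n)" using C by simp_all
    then obtain \<eta> where \<eta>: "0 < \<eta>" "\<And>T. nonexpansive T \<Longrightarrow> rho C T < \<eta> \<Longrightarrow>
        squeezes T (real (Suc n)) (1 / real (Suc n))"
      by (rule contraction_neighbourhood[where s = "real (Suc n)"]) blast
    have "squeezes T (real (Suc n)) (1 / real (Suc n))" if "T \<in> mball C \<eta>" for T
    proof (rule \<eta>(2))
      have "T \<in> F" "d C T < \<eta>" using that by simp_all
      then show "nonexpansive T" "rho C T < \<eta>"
        using assms(1) assms(4)[of C T] C by auto
    qed
    with \<eta>(1) show ?thesis by blast
  qed
  define B where "B n = {mball C \<eta> | C \<eta>. C \<in> ?K \<and> 0 < \<eta> \<and>
    (\<forall>T\<in>mball C \<eta>. squeezes T (real (Suc n)) (1 / real (Suc n)))}" for n :: nat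
  define U where "U n = \<Union> (B n)" for n :: nat
  have U_open: "openin mtopology (U n)" for n
    unfolding U_def by (rule openin_Union) (auto simp: B_def)
  have U_sub: "U n \<subseteq> F" for n
    using openin_subset[OF U_open[of n]] by simp
  have U_dense: "mtopology closure_of U n = F" for n
  proof
    show "mtopology closure_of U n \<subseteq> F"
      using closure_of_subset_topspace[of mtopology "U n"] by simp
    have "?K \<subseteq> U n"
    proof
      fix C assume C: "C \<in> ?K"
      then obtain \<eta> where "0 < \<eta>"
        "\<forall>T\<in>mball C \<eta>. squeezes T (real (Suc n)) (1 / real (Suc n))"
        using nbhd[OF C, of n] by (elim exE conjE)
      with C have "mball C \<eta> \<in> B n" unfolding B_def by blast
      moreover have "C \<in> mball C \<eta>" using C \<open>0 < \<eta>\<close> by simp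
      ultimately show "C \<in> U n" unfolding U_def by (rule UnionI)
    qed
    then show "F \<subseteq> mtopology closure_of U n"
      using closure_of_mono[of ?K "U n" mtopology] assms(5) by simp
  qed
  have U_squeezes: "squeezes T (real (Suc n)) (1 / real (Suc n))" if "T \<in> U n" for T n
    using that unfolding U_def B_def by (elim UnionE CollectE exE conjE) simp
  have sr: "super_regular T" if T: "T \<in> (\<Inter>n. U n)" for T
  proof (rule super_regular_if_squeezes)
    fix s \<epsilon> :: real assume "0 < \<epsilon>"
    obtain n :: nat where n: "max s (1 / \<epsilon>) \<le> real n" using real_arch_simple by blast
    then have "1 / \<epsilon> \<le> real (Suc n)" by simp
    then have "1 / real (Suc n) \<le> \<epsilon>"
      using \<open>0 < \<epsilon>\<close> by (simp add: field_simps)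
    moreover have "s \<le> real (Suc n)" using n by simp
    ultimately show "squeezes T s \<epsilon>"
      using squeezes_mono U_squeezes[of T n] T by blast
  qed
  have singleton: "Fix T = (\<lambda>x. x - T x) -` {0} \<and> Fix T \<noteq> {} \<and> is_singleton (Fix T)"
    if T: "T \<in> (\<Inter>n. U n)" for T
  proof -
    have "nonexpansive T" using T U_sub assms(1) by blast
    then have "continuous_on UNIV T"
      unfolding nonexpansive_def by (rule lipschitz_on_continuous_on)
    then obtain z where "Fix T = {z}" using super_regular_Fix[OF sr[OF T]] by blast
    moreover have "Fix T = (\<lambda>x. x - T x) -` {0}" by (auto simp: Fix_def)
    ultimately show ?thesis by simp
  qed
  show ?thesis
  proof (intro exI[of _ "\<Inter>n. U n"] conjI exI[of _ U] allI)
    show "(\<Inter>n. U n) \<subseteq> F" using U_sub by blast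
    show "\<forall>T\<in>\<Inter>n. U n. super_regular T" using sr by (intro ballI)
    show "\<forall>T\<in>\<Inter>n. U n. Fix T = (\<lambda>x. x - T x) -` {0} \<and> Fix T \<noteq> {} \<and> is_singleton (Fix T)"
      using singleton by (intro ballI)
  qed (use U_open U_dense in simp_all)
qed

end
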